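(* Let $K$ be a field and let $\mathcal{P}\subset\mathbb{R}^n$ be a locally anti-blocking lattice polytope of dimension $n$, with anti-blocking pieces $\mathcal{P}_\varepsilon$ ($\varepsilon\in\{-1,1\}^n$). Then the toric ring $K[\mathcal{P}]$ is normal if and only if the toric ring $K[\mathcal{P}_\varepsilon]$ is normal for every $\varepsilon\in\{-1,1\}^n$.
   Context: A lattice polytope is a convex polytope whose vertices have integer coordinates. A lattice polytope $\mathcal{Q}\subset\mathbb{R}_{\ge0}^n$ of dimension $n$ is anti-blocking if for every $\mathbf{y}\in\mathcal{Q}$ and $\mathbf{x}\in\mathbb{R}^n$ with $0\le x_i\le y_i$ for all $i$, one has $\mathbf{x}\in\mathcal{Q}$. For $\varepsilon\in\{-1,1\}^n$ and $\mathbf{x}\in\mathbb{R}^n$, $\varepsilon\mathbf{x}:=(\varepsilon_1x_1,\dots,\varepsilon_nx_n)$, and $\mathcal{Q}^{\pm}:=\{\varepsilon\mathbf{x}:\varepsilon\in\{-1,1\}^n,\mathbf{x}\in\mathcal{Q}\}$. For $\varepsilon\in\{-1,1\}^n$ let $\mathbb{R}^n_\varepsilon=\{\mathbf{x}\in\mathbb{R}^n: x_i\varepsilon_i\ge0 \text{ for all } i\}$. A lattice polytope $\mathcal{P}\subset\mathbb{R}^n$ of dimension $n$ is locally anti-blocking if for each $\varepsilon\in\{-1,1\}^n$ there is an anti-blocking lattice polytope $\mathcal{P}_\varepsilon\subset\mathbb{R}_{\ge0}^n$ of dimension $n$ (the anti-blocking piece corresponding to $\varepsilon$) with $\mathcal{P}\cap\mathbb{R}^n_\varepsilon=\mathcal{P}_\varepsilon^{\pm}\cap\mathbb{R}^n_\varepsilon$.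 For a lattice polytope $\mathcal{Q}$ with $\mathcal{Q}\cap\mathbb{Z}^n=\{\mathbf{a}_1,\dots,\mathbf{a}_m\}$, the toric ring $K[\mathcal{Q}]$ is the subalgebra of $K[t_1^{\pm1},\dots,t_n^{\pm1},s]$ generated by $\mathbf{t}^{\mathbf{a}_i}s$, $1\le i\le m$. *)

theory Defs
  imports
    "HOL-Analysis.Analysis"
    "HOL-Library.Poly_Mapping"
    "HOL-Library.Countable"
    "HOL-Computational_Algebra.Polynomial"
    "HOL-Computational_Algebra.Fraction_Field"
begin

subsection \<open>Locally anti-blocking lattice polytopes\<close>

text \<open>The ambient space is \<open>real ^ 'n\<close>, with \<open>n = CARD('n)\<close>.\<close>

definition lattice_polytope :: "(real ^ 'n) set \<Rightarrow> bool" where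
  "lattice_polytope P \<longleftrightarrow>
     polytope P \<and> (\<forall>v. v extreme_point_of P \<longrightarrow> (\<forall>i. v $ i \<in> \<int>))"

definition nonneg_orthant :: "(real ^ 'n) set" where
  "nonneg_orthant = {x. \<forall>i. 0 \<le> x $ i}"

definition anti_blocking :: "(real ^ 'n) set \<Rightarrow> bool" where
  "anti_blocking Q \<longleftrightarrow>
     lattice_polytope Q \<and> Q \<subseteq> nonneg_orthant \<and> aff_dim Q = int CARD('n) \<and>
     (\<forall>y\<in>Q. \<forall>x. (\<forall>i. 0 \<le> x $ i \<and> x $ i \<le> y $ i) \<longrightarrow> x \<in> Q)"

definition sign_vectors :: "(real ^ 'n) set" where
  "sign_vectors = {\<epsilon>. \<forall>i. \<epsilon> $ i \<in> {-1, 1}}"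

definition sign_act :: "real ^ 'n \<Rightarrow> real ^ 'n \<Rightarrow> real ^ 'n" where
  "sign_act \<epsilon> x = (\<chi> i. \<epsilon> $ i * x $ i)"

definition pm_closure :: "(real ^ 'n) set \<Rightarrow> (real ^ 'n) set" where
  "pm_closure Q = {sign_act \<epsilon> x | \<epsilon> x. \<epsilon> \<in> sign_vectors \<and> x \<in> Q}"

definition orthant :: "real ^ 'n \<Rightarrow> (real ^ 'n) set" where
  "orthant \<epsilon> = {x. \<forall>i. 0 \<le> x $ i * \<epsilon> $ i}"

definition anti_blocking_piece ::
    "(real ^ 'n) set \<Rightarrow> real ^ 'n \<Rightarrow> (real ^ 'n) set \<Rightarrow> bool" where
  "anti_blocking_piece P \<epsilon> Q \<longleftrightarrow>
     anti_blocking Q \<and> P \<inter> orthant \<epsilon> = pm_closure Q \<inter> orthant \<epsilon>"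

definition locally_anti_blocking :: "(real ^ 'n) set \<Rightarrow> bool" where
  "locally_anti_blocking P \<longleftrightarrow>
     lattice_polytope P \<and> aff_dim P = int CARD('n) \<and>
     (\<forall>\<epsilon>\<in>sign_vectors. \<exists>Q. anti_blocking_piece P \<epsilon> Q)"

definition lattice_points :: "(real ^ 'n) set \<Rightarrow> (int ^ 'n) set" where
  "lattice_points P = {a. (\<chi> i. real_of_int (a $ i)) \<in> P}"

subsection \<open>The ring of Laurent polynomials in t and polynomials in s\<close>

text \<open>
  \<open>Expo a k\<close> is the exponent of the monomial \<open>t^a s^k\<close>. It is a type of its own, rather than
  \<open>(int ^ 'n) \<times> nat\<close>, only because the library derives the integral domain structure of
  \<open>'e \<Rightarrow>\<^sub>0 'k\<close> from a linear order on \<open>'e\<close> that is compatible with addition. The order chosen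
  below is a lexicographic one, and plays no other role.
\<close>

datatype 'n expo = Expo (t_expo: "int ^ 'n") (s_expo: nat)

instantiation expo :: (finite) cancel_comm_monoid_add
begin

definition zero_expo_def: "0 = Expo 0 0"
definition plus_expo_def: "e + f = Expo (t_expo e + t_expo f) (s_expo e + s_expo f)"
definition minus_expo_def: "e - f = Expo (t_expo e - t_expo f) (s_expo e - s_expo f)"

instance
  by intro_classes
    (auto simp: zero_expo_def plus_expo_def minus_expo_def algebra_simps intro: expo.expand)

end

definition expo_coord :: "'n::finite expo \<Rightarrow> nat \<Rightarrow> int" where
  "expo_coord e k =
     (if k = 0 then int (s_expo e)
      else if k - 1 \<in> range (to_nat :: 'n \<Rightarrow> nat) then t_expo e $ from_nat (k - 1) else 0)"

lemma finite_expo_coord: "finite {k. expo_coord (e :: 'n::finite expo) k \<noteq> 0}"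
proof (rule finite_subset)
  show "{k. expo_coord e k \<noteq> 0} \<subseteq> insert 0 (Suc ` range (to_nat :: 'n \<Rightarrow> nat))"
  proof
    fix k assume "k \<in> {k. expo_coord e k \<noteq> 0}"
    then show "k \<in> insert 0 (Suc ` range (to_nat :: 'n \<Rightarrow> nat))"
      by (cases k) (auto simp: expo_coord_def split: if_splits)
  qed
qed simp

definition expo_key :: "'n::finite expo \<Rightarrow> nat \<Rightarrow>\<^sub>0 int" where
  "expo_key e = Abs_poly_mapping (expo_coord e)"

lemma lookup_expo_key: "Poly_Mapping.lookup (expo_key e) = expo_coord e"
  using finite_expo_coord[of e] by (simp add: expo_key_def)

lemma expo_key_add: "expo_key (e + f) = expo_key e + expo_key f"
  by (rule poly_mapping_eqI)
    (simp add: lookup_add lookup_expo_key expo_coord_def plus_expo_def)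

lemma inj_expo_key: "inj expo_key"
proof (rule injI)
  fix e f :: "'n::finite expo"
  assume "expo_key e = expo_key f"
  then have eq: "expo_coord e k = expo_coord f k" for k
    by (metis lookup_expo_key)
  have "s_expo e = s_expo f"
    using eq[of 0] by (simp add: expo_coord_def)
  moreover have "t_expo e $ i = t_expo f $ i" for i
    using eq[of "Suc (to_nat i)"] by (simp add: expo_coord_def)
  ultimately show "e = f"
    by (simp add: expo.expand vec_eq_iff)
qed

instantiation expo :: (finite) linorder
begin

definition less_eq_expo_def: "e \<le> f \<longleftrightarrow> expo_key e \<le> expo_key f"
definition less_expo_def: "e < f \<longleftrightarrow> expo_key e < expo_key f"

instance
  by intro_classes
    (auto simp: less_eq_expo_def less_expo_def dest: injD[OF inj_expo_key])

end

instance expo :: (finite) ordered_cancel_comm_monoid_add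
  by intro_classes (simp add: less_eq_expo_def expo_key_add add_left_mono)

type_synonym ('n, 'k) laurent = "'n expo \<Rightarrow>\<^sub>0 'k"

subsection \<open>Toric rings\<close>

inductive_set generated_subalgebra ::
    "('n::finite, 'k::field) laurent set \<Rightarrow> ('n, 'k) laurent set"
  for G :: "('n, 'k) laurent set" where
  scalar: "Poly_Mapping.single 0 c \<in> generated_subalgebra G"
| gen: "g \<in> G \<Longrightarrow> g \<in> generated_subalgebra G"
| add: "p \<in> generated_subalgebra G \<Longrightarrow> q \<in> generated_subalgebra G \<Longrightarrow>
    p + q \<in> generated_subalgebra G"
| mult: "p \<in> generated_subalgebra G \<Longrightarrow> q \<in> generated_subalgebra G \<Longrightarrow>
    p * q \<in> generated_subalgebra G"

definition toric_ring :: "(real ^ 'n) set \<Rightarrow> ('n::finite, 'k::field) laurent set" where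
  "toric_ring Q =
     generated_subalgebra ((\<lambda>a. Poly_Mapping.single (Expo a 1) 1) ` lattice_points Q)"

subsection \<open>Normality\<close>

text \<open>
  For a subring \<open>R\<close> of an integral domain, the fraction field of \<open>R\<close> and \<open>R\<close> itself are
  realised inside the fraction field of the ambient domain.
\<close>

definition subring_in_fract :: "'a::idom set \<Rightarrow> 'a fract set" where
  "subring_in_fract R = (\<lambda>a. Fraction_Field.Fract a 1) ` R"

definition fraction_field_of :: "'a::idom set \<Rightarrow> 'a fract set" where
  "fraction_field_of R = {Fraction_Field.Fract a b | a b. a \<in> R \<and> b \<in> R \<and> b \<noteq> 0}"

definition integral_over :: "'b::comm_ring_1 set \<Rightarrow> 'b \<Rightarrow> bool" where
  "integral_over S x \<longleftrightarrow>
     (\<exists>p. lead_coeff p = 1 \<and> (\<forall>i. coeff p i \<in> S) \<and> poly p x = 0)"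

definition normal_subring :: "'a::idom set \<Rightarrow> bool" where
  "normal_subring R \<longleftrightarrow>
     (\<forall>x\<in>fraction_field_of R.
        integral_over (subring_in_fract R) x \<longrightarrow> x \<in> subring_in_fract R)"

end

theory Submission
  imports Defs "HOL-Real_Asymp.Real_Asymp"
begin

text \<open>
  The toric ring of \<open>Q\<close> is the monoid ring of the monoid \<open>S\<close> generated by the points \<open>(a, 1)\<close>
  with \<open>a \<in> Q\<close> integral. All polytopes involved contain the origin and the unit vectors, so \<open>S\<close>
  generates the full lattice, and normality amounts to the integer decomposition property: every
  lattice point of the cone over \<open>Q\<close> lies in \<open>S\<close>. That normality implies this property is clear
  since some multiple of each lattice point of the cone lies in \<open>S\<close>. Conversely, if \<open>x = f / g\<close> is
  integral, then \<open>d x^k\<close> lies in the ring for some \<open>d \<noteq> 0\<close> and all \<open>k\<close>, so with \<open>u\<close> the leading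
  exponent of \<open>x\<close> the ray \<open>lead d + k u\<close> stays in the cone; hence \<open>u\<close> is in the cone and therefore in
  \<open>S\<close>. One subtracts the leading term and repeats. The order compares exponents of \<open>s\<close> first, so
  only finitely many points of the cone lie below a given one and the process stops.

  The integer decomposition property is local: reflect a lattice point into its own orthant for one
  direction; for the other, replace the summands of a decomposition by their positive parts, whose
  sum dominates the given point, and shrink them using anti-blockingness.
\<close>


subsection \<open>The cone over a polytope and its decomposable points\<close>

definition emb :: "int ^ 'n \<Rightarrow> real ^ 'n" where
  "emb a = (\<chi> i. real_of_int (a $ i))"

lemma emb_nth [simp]: "emb a $ i = real_of_int (a $ i)"
  by (simp add: emb_def)

lemma emb_0 [simp]: "emb 0 = 0"
  by (simp add: vec_eq_iff)

lemma emb_add: "emb (a + b) = emb a + emb b"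
  by (simp add: vec_eq_iff)

lemma mem_lattice_points [simp]: "a \<in> lattice_points Q \<longleftrightarrow> emb a \<in> Q"
  by (simp add: lattice_points_def emb_def)

text \<open>The monoid \<open>S\<close> of the overview. Lists allow repeated summands, and the
  length records the exponent of \<open>s\<close>.\<close>

definition decomposable :: "(real ^ 'n) set \<Rightarrow> 'n::finite expo set" where
  "decomposable Q = {Expo (sum_list xs) (length xs) | xs. set xs \<subseteq> lattice_points Q}"

text \<open>The lattice points of the cone over \<open>Q\<close> placed at height 1. At height 0 the
  equation leaves only the origin.\<close>

definition lattice_cone :: "(real ^ 'n) set \<Rightarrow> 'n::finite expo set" where
  "lattice_cone Q = {e. \<exists>q\<in>Q. emb (t_expo e) = real (s_expo e) *\<^sub>R q}"

text \<open>The integer decomposition property. For nonempty convex \<open>Q\<close> the reverse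
  inclusion always holds, by \<open>decomposable_subset_lattice_cone\<close>.\<close>

definition integrally_decomposable :: "(real ^ 'n::finite) set \<Rightarrow> bool" where
  "integrally_decomposable Q \<longleftrightarrow> lattice_cone Q \<subseteq> decomposable Q"

lemma expo_eq_iff: "e = f \<longleftrightarrow> t_expo e = t_expo f \<and> s_expo e = s_expo f"
  using expo.expand[of e f] by blast

lemma expo_sel_add [simp]:
  "t_expo (e + f) = t_expo e + t_expo f" "s_expo (e + f) = s_expo e + s_expo f"
  by (simp_all add: plus_expo_def)

lemma expo_sel_0 [simp]: "t_expo 0 = 0" "s_expo 0 = 0"
  by (simp_all add: zero_expo_def)

lemma decomposable_0 [simp]: "0 \<in> decomposable Q"
  unfolding decomposable_def zero_expo_def by (rule CollectI, rule exI[of _ "[]"]) auto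

lemma decomposable_point: "emb a \<in> Q \<Longrightarrow> Expo a 1 \<in> decomposable Q"
  unfolding decomposable_def by (rule CollectI, rule exI[of _ "[a]"]) auto

lemma decomposable_add:
  assumes "e \<in> decomposable Q" "f \<in> decomposable Q"
  shows "e + f \<in> decomposable Q"
proof -
  from assms obtain xs ys
    where "e = Expo (sum_list xs) (length xs)" "set xs \<subseteq> lattice_points Q"
      "f = Expo (sum_list ys) (length ys)" "set ys \<subseteq> lattice_points Q"
    unfolding decomposable_def by blast
  then show ?thesis
    unfolding decomposable_def
    by (intro CollectI exI[of _ "xs @ ys"]) (auto simp: plus_expo_def)
qed

lemma decomposable_induct [consumes 1, case_names zero add]:
  assumes "e \<in> decomposable Q"
    and "P 0"
    and "\<And>a f. emb a \<in> Q \<Longrightarrow> f \<in> decomposable Q \<Longrightarrow> P f \<Longrightarrow> P (Expo a 1 + f)"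
  shows "P e"
proof -
  obtain xs where "e = Expo (sum_list xs) (length xs)" "set xs \<subseteq> lattice_points Q"
    using assms(1) unfolding decomposable_def by blast
  then show ?thesis
  proof (induction xs arbitrary: e)
    case Nil
    then show ?case using assms(2) by (simp add: zero_expo_def)
  next
    case (Cons a xs)
    have "Expo (sum_list xs) (length xs) \<in> decomposable Q"
      unfolding decomposable_def using Cons.prems by auto
    with Cons assms(3)[of a "Expo (sum_list xs) (length xs)"] show ?case
      by (simp add: plus_expo_def)
  qed
qed

text \<open>A point \<open>a\<close> of \<open>Q\<close> plus \<open>k\<close> times a point
  \<open>q\<close> of \<open>Q\<close> is \<open>1 + k\<close> times their weighted mean, which lies
  in \<open>Q\<close> by convexity.\<close>

lemma decomposable_subset_lattice_cone:
  assumes "convex Q" "Q \<noteq> {}"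
  shows "decomposable Q \<subseteq> lattice_cone Q"
proof
  fix e assume "e \<in> decomposable Q"
  then show "e \<in> lattice_cone Q"
  proof (induction rule: decomposable_induct)
    case zero
    then show ?case using assms(2) by (auto simp: lattice_cone_def)
  next
    case (add a f)
    then obtain q where q: "q \<in> Q" "emb (t_expo f) = real (s_expo f) *\<^sub>R q"
      by (auto simp: lattice_cone_def)
    define k where "k = real (s_expo f)"
    have k: "k \<ge> 0" by (simp add: k_def)
    have "(1 / (1 + k)) *\<^sub>R emb a + (k / (1 + k)) *\<^sub>R q \<in> Q"
      using k by (intro convexD[OF assms(1)] add q(1)) (auto simp: field_simps)
    moreover have "emb a + k *\<^sub>R q = (1 + k) *\<^sub>R ((1 / (1 + k)) *\<^sub>R emb a + (k / (1 + k)) *\<^sub>R q)"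
      using k by (simp add: scaleR_add_right)
    ultimately show ?case
      using q by (auto simp: lattice_cone_def emb_add k_def)
  qed
qed

subsection \<open>Toric rings as monoid rings\<close>

lemma poly_mapping_sum_single:
  fixes p :: "'a \<Rightarrow>\<^sub>0 'b::comm_monoid_add"
  shows "p = (\<Sum>e\<in>Poly_Mapping.keys p. Poly_Mapping.single e (Poly_Mapping.lookup p e))"
  by (rule poly_mapping_eqI) (auto simp: lookup_sum lookup_single when_def in_keys_iff)

text \<open>The exponents of sums and products stay in the monoid. Conversely, a polynomial is the
  sum of its terms, and each term is a scalar times a product of generators.\<close>

lemma toric_ring_eq:
  "(toric_ring Q :: ('n::finite, 'k::field) laurent set) =
     {p. Poly_Mapping.keys p \<subseteq> decomposable Q}"
  (is "?R = _")
proof (intro set_eqI iffI CollectI)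
  fix p :: "('n, 'k) laurent"
  assume "p \<in> ?R"
  then show "Poly_Mapping.keys p \<subseteq> decomposable Q"
    unfolding toric_ring_def
  proof (induction rule: generated_subalgebra.induct)
    case (gen g)
    then show ?case by (auto simp: decomposable_point simp flip: One_nat_def)
  next
    case (add p q)
    then show ?case using Poly_Mapping.keys_add[of p q] by blast
  next
    case (mult p q)
    then show ?case using keys_mult[of p q] decomposable_add by blast
  qed simp
next
  fix p :: "('n, 'k) laurent"
  assume "p \<in> {p. Poly_Mapping.keys p \<subseteq> decomposable Q}"
  then have keys: "e \<in> decomposable Q" if "e \<in> Poly_Mapping.keys p" for e
    using that by blast
  have unit: "Poly_Mapping.single e (1::'k) \<in> ?R" if "e \<in> decomposable Q" for e
    using that
  proof (induction rule: decomposable_induct)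
    case zero
    then show ?case
      using generated_subalgebra.scalar[of "1::'k"] by (simp add: toric_ring_def)
  next
    case (add a f)
    have "Poly_Mapping.single (Expo a 1) (1::'k) * Poly_Mapping.single f 1 \<in> ?R"
      unfolding toric_ring_def
      by (rule generated_subalgebra.mult)
        (use add in \<open>auto simp: toric_ring_def intro: generated_subalgebra.gen\<close>)
    then show ?case by (simp add: mult_single)
  qed
  have monomial: "Poly_Mapping.single e c \<in> ?R" if "e \<in> decomposable Q" for e and c :: 'k
  proof -
    have "Poly_Mapping.single 0 c * Poly_Mapping.single e 1 \<in> ?R"
      using unit[OF that] unfolding toric_ring_def
      by (intro generated_subalgebra.mult generated_subalgebra.scalar)
    then show ?thesis by (simp add: mult_single)
  qed
  have sum: "sum f A \<in> ?R" if "\<And>e. e \<in> A \<Longrightarrow> f e \<in> ?R"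
    for f and A :: "'n expo set"
    using that
  proof (induction A rule: infinite_finite_induct)
    case (insert x F)
    then show ?case by (auto simp: toric_ring_def intro: generated_subalgebra.add)
  qed (use generated_subalgebra.scalar[of 0] in \<open>simp_all add: toric_ring_def\<close>)
  have "(\<Sum>e\<in>Poly_Mapping.keys p. Poly_Mapping.single e (Poly_Mapping.lookup p e)) \<in> ?R"
    by (intro sum monomial keys)
  then show "p \<in> ?R"
    by (subst poly_mapping_sum_single)
qed

subsection \<open>Leading exponents\<close>

text \<open>Addition is strictly monotone, so \<open>a \<le> u\<close>, \<open>b \<le> v\<close> and
  \<open>a + b = u + v\<close> force \<open>a = u\<close> and \<open>b = v\<close>. A single term of
  the convolution survives.\<close>

lemma lookup_mult_add_Max:
  fixes f g :: "'a::{ordered_cancel_comm_monoid_add, linorder} \<Rightarrow>\<^sub>0 'b::semiring_no_zero_divisors"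
  assumes "\<And>a. a \<in> Poly_Mapping.keys f \<Longrightarrow> a \<le> u" "\<And>b. b \<in> Poly_Mapping.keys g \<Longrightarrow> b \<le> v"
  shows "Poly_Mapping.lookup (f * g) (u + v) = Poly_Mapping.lookup f u * Poly_Mapping.lookup g v"
proof -
  have "Poly_Mapping.lookup f a * (\<Sum>b. Poly_Mapping.lookup g b when u + v = a + b) =
      (Poly_Mapping.lookup f u * Poly_Mapping.lookup g v when u = a)" for a
  proof (cases "a \<in> Poly_Mapping.keys f")
    case False
    then show ?thesis by (auto simp: when_def in_keys_iff)
  next
    case a: True
    have "(Poly_Mapping.lookup g b when u + v = a + b) = (Poly_Mapping.lookup g v when u = a when v = b)" for b
    proof (cases "b \<in> Poly_Mapping.keys g")
      case True
      then show ?thesis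
        using assms(1)[OF a] assms(2)[OF True] add_strict_mono[of a u b v]
        by (auto simp: when_def order_le_less)
    qed (auto simp: when_def in_keys_iff)
    then show ?thesis by (simp add: when_def)
  qed
  then show ?thesis
    by (simp add: lookup_mult)
qed

lemma Max_keys_mult:
  fixes f g :: "'a::{ordered_cancel_comm_monoid_add, linorder} \<Rightarrow>\<^sub>0 'b::semiring_no_zero_divisors"
  assumes "f \<noteq> 0" "g \<noteq> 0"
  shows "Max (Poly_Mapping.keys (f * g)) = Max (Poly_Mapping.keys f) + Max (Poly_Mapping.keys g)"
proof (rule Max_eqI)
  have "Max (Poly_Mapping.keys f) \<in> Poly_Mapping.keys f" "Max (Poly_Mapping.keys g) \<in> Poly_Mapping.keys g"
    using assms by (simp_all add: Max_in)
  then show "Max (Poly_Mapping.keys f) + Max (Poly_Mapping.keys g) \<in> Poly_Mapping.keys (f * g)"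
    using lookup_mult_add_Max[of f "Max (Poly_Mapping.keys f)" g "Max (Poly_Mapping.keys g)"]
    by (simp add: in_keys_iff)
next
  fix e assume "e \<in> Poly_Mapping.keys (f * g)"
  then obtain a b where "e = a + b" "a \<in> Poly_Mapping.keys f" "b \<in> Poly_Mapping.keys g"
    using keys_mult[of f g] by blast
  then show "e \<le> Max (Poly_Mapping.keys f) + Max (Poly_Mapping.keys g)"
    by (simp add: add_mono)
qed simp


section \<open>Finiteness of the lattice cone below an exponent\<close>

text \<open>Coordinate 0 of \<open>expo_coord\<close> is the exponent of \<open>s\<close>, so the
  lexicographic comparison looks at it first.\<close>

lemma expo_le_imp_s_expo_le:
  assumes "e \<le> f"
  shows "s_expo e \<le> s_expo f"
proof -
  have "e = f \<or> less_fun (expo_coord e) (expo_coord f)"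
  proof -
    have "less_fun (expo_coord e) (expo_coord f) \<or> expo_key e = expo_key f"
      using assms
      by (simp add: less_eq_expo_def less_eq_poly_mapping.rep_eq lookup_expo_key poly_mapping_eq_iff)
    then show ?thesis using injD[OF inj_expo_key] by blast
  qed
  then show ?thesis
  proof
    assume "less_fun (expo_coord e) (expo_coord f)"
    then obtain k where "expo_coord e k < expo_coord f k" "\<forall>k'<k. expo_coord e k' = expo_coord f k'"
      unfolding less_fun_def by blast
    then show ?thesis
      by (cases k) (auto simp: expo_coord_def)
  qed simp
qed

lemma finite_vec_of_finite:
  assumes "finite A"
  shows "finite {a :: 'a ^ 'n. \<forall>i. a $ i \<in> A}"
proof (rule finite_surj)
  show "finite (PiE (UNIV :: 'n set) (\<lambda>_. A))"
    using assms by (simp add: finite_PiE)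
  show "{a :: 'a ^ 'n. \<forall>i. a $ i \<in> A} \<subseteq> vec_lambda ` PiE UNIV (\<lambda>_. A)"
    by (rule subsetI, rule image_eqI[where x = "vec_nth _"]) auto
qed

lemma finite_lattice_cone_bounded:
  fixes Q :: "(real ^ 'n::finite) set"
  assumes "bounded Q"
  shows "finite {e \<in> lattice_cone Q. s_expo e \<le> N}"
proof -
  obtain B where B: "B > 0" "\<And>q. q \<in> Q \<Longrightarrow> norm q \<le> B"
    using assms bounded_pos by blast
  define M where "M = \<lceil>real N * B\<rceil>"
  have "e \<in> case_prod Expo ` ({a. \<forall>i. a $ i \<in> {-M..M}} \<times> {..N})"
    if e: "e \<in> lattice_cone Q" "s_expo e \<le> N" for e
  proof -
    obtain q where q: "q \<in> Q" "emb (t_expo e) = real (s_expo e) *\<^sub>R q"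
      using e(1) by (auto simp: lattice_cone_def)
    have "\<bar>t_expo e $ i\<bar> \<le> M" for i
    proof -
      have "real_of_int \<bar>t_expo e $ i\<bar> = \<bar>emb (t_expo e) $ i\<bar>" by simp
      also have "\<dots> \<le> norm (emb (t_expo e))" by (rule component_le_norm_cart)
      also have "\<dots> = real (s_expo e) * norm q" using q(2) by simp
      also have "\<dots> \<le> real N * B" using e(2) B q(1) by (intro mult_mono) auto
      also have "\<dots> \<le> real_of_int M" by (simp add: M_def)
      finally show ?thesis by linarith
    qed
    then have "\<forall>i. t_expo e $ i \<in> {-M..M}" by (auto simp: abs_le_iff minus_le_iff)
    then show ?thesis
      using e(2) by (intro image_eqI[where x = "(t_expo e, s_expo e)"]) auto
  qed
  then have "{e \<in> lattice_cone Q. s_expo e \<le> N} \<subseteq>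
      case_prod Expo ` ({a. \<forall>i. a $ i \<in> {-M..M}} \<times> {..N})"
    by blast
  moreover have "finite (case_prod Expo ` ({a :: int ^ 'n. \<forall>i. a $ i \<in> {-M..M}} \<times> {..N}))"
    by (intro finite_imageI finite_cartesian_product finite_vec_of_finite) auto
  ultimately show ?thesis by (rule finite_subset)
qed

text \<open>After division by the height \<open>r + k c\<close>, the points of the ray lie in
  \<open>Q\<close> and tend to \<open>b / c\<close>, which compactness keeps in \<open>Q\<close>. If
  \<open>c = 0\<close> the height stays \<open>r\<close>, the ray is bounded, and \<open>b\<close>
  must vanish.\<close>

lemma cone_contains_asymptotic_direction:
  fixes Q :: "'a::euclidean_space set"
  assumes "compact Q"
    and ray: "\<And>k::nat. \<exists>q\<in>Q. a + real k *\<^sub>R b = (r + real k * c) *\<^sub>R q"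
    and "0 \<le> r" "0 \<le> c"
  shows "\<exists>q\<in>Q. b = c *\<^sub>R q"
proof -
  obtain q where q: "\<And>k. q k \<in> Q" "\<And>k. a + real k *\<^sub>R b = (r + real k * c) *\<^sub>R q k"
    using ray by metis
  show ?thesis
  proof (cases "c = 0")
    case True
    obtain B where B: "\<And>x. x \<in> Q \<Longrightarrow> norm x \<le> B"
      using compact_imp_bounded[OF assms(1)] bounded_iff by blast
    have "real k * norm b \<le> norm a + r * B" for k
    proof -
      have "real k * norm b = norm ((a + real k *\<^sub>R b) - a)" by simp
      also have "\<dots> \<le> norm a + norm (r *\<^sub>R q k)"
        unfolding q(2) using True norm_triangle_ineq4[of "r *\<^sub>R q k" a] by simp
      also have "\<dots> \<le> norm a + r * B"
        using B[OF q(1)] assms(3) by (simp add: mult_left_mono)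
      finally show ?thesis .
    qed
    then have "norm b = 0"
      by (metis norm_ge_zero ex_less_of_nat_mult not_less order_le_less)
    then show ?thesis using True q(1) by auto
  next
    case False
    then have c: "c > 0" using assms(4) by simp
    \<comment> \<open>The sequence starts at \<open>Suc k\<close> because the height
      \<open>r\<close> at index 0 may be zero.\<close>
    have "(\<lambda>k. (1 / (r + real (Suc k) * c)) *\<^sub>R a + (real (Suc k) / (r + real (Suc k) * c)) *\<^sub>R b)
        \<longlonglongrightarrow> 0 *\<^sub>R a + (1 / c) *\<^sub>R b"
      using c by (intro tendsto_add tendsto_scaleR tendsto_const) (real_asymp simp: field_simps)+
    moreover have "(1 / (r + real (Suc k) * c)) *\<^sub>R a + (real (Suc k) / (r + real (Suc k) * c)) *\<^sub>R b
        = q (Suc k)" for k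
    proof -
      have pos: "r + real (Suc k) * c > 0" using c assms(3) by (simp add: add_nonneg_pos)
      have "(1 / (r + real (Suc k) * c)) *\<^sub>R (a + real (Suc k) *\<^sub>R b) = q (Suc k)"
        unfolding q(2) using pos by simp
      then show ?thesis by (simp add: scaleR_add_right)
    qed
    ultimately have "(1 / c) *\<^sub>R b \<in> Q"
      using closed_sequentially[OF compact_imp_closed[OF assms(1)], of "\<lambda>k. q (Suc k)"] q(1)
      by simp
    then show ?thesis using c by (intro bexI[of _ "(1 / c) *\<^sub>R b"]) auto
  qed
qed

section \<open>Closure properties of the toric ring\<close>

lemma toric_ring_add: "p \<in> toric_ring Q \<Longrightarrow> q \<in> toric_ring Q \<Longrightarrow> p + q \<in> toric_ring Q"
  unfolding toric_ring_def by (rule generated_subalgebra.add)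

lemma toric_ring_mult: "p \<in> toric_ring Q \<Longrightarrow> q \<in> toric_ring Q \<Longrightarrow> p * q \<in> toric_ring Q"
  unfolding toric_ring_def by (rule generated_subalgebra.mult)

lemma toric_ring_const: "Poly_Mapping.single 0 c \<in> toric_ring Q"
  unfolding toric_ring_def by (rule generated_subalgebra.scalar)

lemma toric_ring_0: "0 \<in> toric_ring Q"
  using toric_ring_const[of 0] by simp

lemma toric_ring_1: "1 \<in> toric_ring Q"
  using toric_ring_const[of 1] by simp

lemma toric_ring_uminus: "p \<in> toric_ring Q \<Longrightarrow> - p \<in> toric_ring Q"
  by (simp add: toric_ring_eq)

lemma toric_ring_of_nat: "of_nat n \<in> toric_ring Q"
  by (induction n) (simp_all add: toric_ring_0 toric_ring_1 toric_ring_add)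

lemma toric_ring_power: "p \<in> toric_ring Q \<Longrightarrow> p ^ n \<in> toric_ring Q"
  by (induction n) (simp_all add: toric_ring_1 toric_ring_mult)

lemma toric_ring_sum: "(\<And>i. i \<in> I \<Longrightarrow> f i \<in> toric_ring Q) \<Longrightarrow> sum f I \<in> toric_ring Q"
  by (induction I rule: infinite_finite_induct) (simp_all add: toric_ring_0 toric_ring_add)

lemma Max_keys_power:
  fixes f :: "('n::finite, 'k::field) laurent"
  assumes "f \<noteq> 0"
  shows "t_expo (Max (Poly_Mapping.keys (f ^ k))) $ i = int k * t_expo (Max (Poly_Mapping.keys f)) $ i"
    and "s_expo (Max (Poly_Mapping.keys (f ^ k))) = k * s_expo (Max (Poly_Mapping.keys f))"
  using assms by (induction k) (simp_all add: Max_keys_mult algebra_simps)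

section \<open>Almost integral quotients\<close>

text \<open>The last assumption says that \<open>d (f / g)^k\<close> lies in the ring for all
  \<open>k\<close>. Leading exponents are additive, so the leading exponent of \<open>d\<close> plus
  \<open>k\<close> times the difference of those of \<open>f\<close> and \<open>g\<close> stays in
  the cone, and the asymptotic direction of this ray lies in the cone too.\<close>

lemma almost_integral_leading_exponent:
  fixes f g d :: "('n::finite, 'k::field) laurent"
  assumes Q: "compact Q" "convex Q" "Q \<noteq> {}"
    and "f \<noteq> 0" "g \<noteq> 0" "d \<noteq> 0"
    and alm: "\<And>k. \<exists>h\<in>toric_ring Q. d * f ^ k = g ^ k * h"
  obtains u where "u \<in> lattice_cone Q" "Max (Poly_Mapping.keys f) = Max (Poly_Mapping.keys g) + u"
proof -
  define lead where "lead = (\<lambda>p :: ('n, 'k) laurent. Max (Poly_Mapping.keys p))"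
  have ex: "\<exists>e\<in>lattice_cone Q. lead d + lead (f ^ k) = lead (g ^ k) + e" for k
  proof -
    obtain h where h: "h \<in> toric_ring Q" "d * f ^ k = g ^ k * h" using alm by blast
    have "h \<noteq> 0" using h(2) assms by auto
    then have "lead h \<in> Poly_Mapping.keys h" by (simp add: lead_def Max_in)
    then have "lead h \<in> lattice_cone Q"
      using h(1) decomposable_subset_lattice_cone[OF Q(2,3)]
      by (auto simp: toric_ring_eq)
    moreover have "lead (d * f ^ k) = lead (g ^ k * h)" by (simp add: h(2))
    ultimately show ?thesis
      using \<open>h \<noteq> 0\<close> assms by (auto simp: lead_def Max_keys_mult)
  qed
  have s: "\<exists>n. s_expo (lead d) + k * s_expo (lead f) = k * s_expo (lead g) + n" for k
    using ex[of k] assms(4,5) by (auto simp: expo_eq_iff lead_def Max_keys_power)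
  \<comment> \<open>This makes the truncated subtraction in \<open>u\<close> below exact. Otherwise
    the left side of \<open>s\<close> falls behind the right one as soon as \<open>k\<close> exceeds
    \<open>s_expo (lead d)\<close>.\<close>
  have le: "s_expo (lead g) \<le> s_expo (lead f)"
  proof (rule ccontr)
    assume "\<not> ?thesis"
    then have "Suc (s_expo (lead f)) \<le> s_expo (lead g)" by simp
    then have "Suc (s_expo (lead d)) * Suc (s_expo (lead f)) \<le> Suc (s_expo (lead d)) * s_expo (lead g)"
      by (rule mult_le_mono2)
    with s[of "Suc (s_expo (lead d))"] show False by auto
  qed
  define u where "u = Expo (t_expo (lead f) - t_expo (lead g)) (s_expo (lead f) - s_expo (lead g))"
  have u: "lead f = lead g + u"
    using le by (simp add: u_def expo_eq_iff)
  have "\<exists>q\<in>Q. emb (t_expo u) = real (s_expo u) *\<^sub>R q"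
  proof (rule cone_contains_asymptotic_direction[OF Q(1)])
    fix k :: nat
    obtain e where e: "e \<in> lattice_cone Q" "lead d + lead (f ^ k) = lead (g ^ k) + e"
      using ex by blast
    then obtain q where q: "q \<in> Q" "emb (t_expo e) = real (s_expo e) *\<^sub>R q"
      by (auto simp: lattice_cone_def)
    have "emb (t_expo e) = emb (t_expo (lead d)) + real k *\<^sub>R emb (t_expo u)"
    proof -
      have "t_expo (lead d) $ i + int k * t_expo (lead f) $ i
          = int k * t_expo (lead g) $ i + t_expo e $ i" for i
        using arg_cong[OF e(2), of "\<lambda>x. t_expo x $ i"] assms(4,5)
        by (simp add: lead_def Max_keys_power)
      then have "t_expo e $ i = t_expo (lead d) $ i + int k * t_expo u $ i" for i
        by (simp add: u_def algebra_simps)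
      then show ?thesis by (simp add: vec_eq_iff)
    qed
    moreover have "real (s_expo e) = real (s_expo (lead d)) + real k * real (s_expo u)"
    proof -
      have "s_expo (lead d) + k * s_expo (lead f) = k * s_expo (lead g) + s_expo e"
        using arg_cong[OF e(2), of s_expo] assms(4,5) by (simp add: lead_def Max_keys_power)
      then have "s_expo e = s_expo (lead d) + k * s_expo u"
        unfolding u by (simp add: algebra_simps)
      then show ?thesis by simp
    qed
    ultimately show "\<exists>q\<in>Q. emb (t_expo (lead d)) + real k *\<^sub>R emb (t_expo u) =
        (real (s_expo (lead d)) + real k * real (s_expo u)) *\<^sub>R q"
      using q by metis
  qed auto
  then show ?thesis
    using u by (intro that[of u]) (auto simp: lattice_cone_def lead_def)
qed

text \<open>In the binomial expansion the term with \<open>f ^ i\<close> already carries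
  \<open>g ^ (k - i)\<close>, and \<open>d * f ^ i\<close> contributes the missing factor
  \<open>g ^ i\<close>.\<close>

lemma almost_integral_diff:
  fixes f g d :: "('n::finite, 'k::field) laurent"
  assumes alm: "\<And>k. \<exists>h\<in>toric_ring Q. d * f ^ k = g ^ k * h"
    and s: "s \<in> toric_ring Q"
  shows "\<exists>h\<in>toric_ring Q. d * (f - s * g) ^ k = g ^ k * h"
proof -
  obtain h where h: "\<And>k. h k \<in> toric_ring Q" "\<And>k. d * f ^ k = g ^ k * h k"
    using alm by metis
  have "d * (f - s * g) ^ k = d * (f + (- s * g)) ^ k" by simp
  also have "\<dots> = (\<Sum>i\<le>k. d * (of_nat (k choose i) * f ^ i * (- s * g) ^ (k - i)))"
    by (subst binomial_ring) (rule sum_distrib_left)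
  also have "\<dots> = (\<Sum>i\<le>k. g ^ k * (of_nat (k choose i) * h i * (- s) ^ (k - i)))"
  proof (rule sum.cong[OF refl])
    fix i assume "i \<in> {..k}"
    then have "g ^ k = g ^ i * g ^ (k - i)" by (simp flip: power_add)
    have "d * (of_nat (k choose i) * f ^ i * (- s * g) ^ (k - i))
        = (d * f ^ i) * (of_nat (k choose i) * (- s * g) ^ (k - i))"
      by (simp only: ac_simps)
    also have "\<dots> = g ^ i * h i * (of_nat (k choose i) * ((- s) ^ (k - i) * g ^ (k - i)))"
      by (simp only: h(2) power_mult_distrib)
    also have "\<dots> = g ^ k * (of_nat (k choose i) * h i * (- s) ^ (k - i))"
      unfolding \<open>g ^ k = g ^ i * g ^ (k - i)\<close> by (simp only: ac_simps)
    finally show "d * (of_nat (k choose i) * f ^ i * (- s * g) ^ (k - i))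
        = g ^ k * (of_nat (k choose i) * h i * (- s) ^ (k - i))" .
  qed
  also have "\<dots> = g ^ k * (\<Sum>i\<le>k. of_nat (k choose i) * h i * (- s) ^ (k - i))"
    by (rule sum_distrib_left[symmetric])
  finally show ?thesis
    by (intro bexI[where x = "\<Sum>i\<le>k. of_nat (k choose i) * h i * (- s) ^ (k - i)"])
      (auto intro!: toric_ring_sum toric_ring_mult toric_ring_of_nat toric_ring_power
        toric_ring_uminus h(1) s)
qed

text \<open>Division by \<open>g\<close> with cancellation of leading terms; integer decomposition
  puts each term of the quotient into the ring. The order on exponents is not well-founded, so the
  induction counts the cone points that can still occur as leading exponents of the
  quotient.\<close>

lemma almost_integral_imp_multiple:
  fixes f g d :: "('n::finite, 'k::field) laurent"
  assumes Q: "compact Q" "convex Q" "Q \<noteq> {}"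
    and "integrally_decomposable Q"
    and "g \<noteq> 0" "d \<noteq> 0"
    and "\<And>k. \<exists>h\<in>toric_ring Q. d * f ^ k = g ^ k * h"
  shows "\<exists>h\<in>toric_ring Q. f = h * g"
proof -
  define below where "below = (\<lambda>p :: ('n, 'k) laurent.
    {e \<in> lattice_cone Q. Max (Poly_Mapping.keys g) + e \<le> Max (Poly_Mapping.keys p)})"
  have fin: "finite (below p)" for p
  proof (rule finite_subset)
    show "below p \<subseteq> {e \<in> lattice_cone Q. s_expo e \<le> s_expo (Max (Poly_Mapping.keys p))}"
      by (auto simp: below_def dest!: expo_le_imp_s_expo_le)
  qed (rule finite_lattice_cone_bounded[OF compact_imp_bounded[OF Q(1)]])
  show ?thesis
    using assms(7)
  proof (induction "card (below f)" arbitrary: f rule: less_induct)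
    case less
    show ?case
    proof (cases "f = 0")
      case True
      then show ?thesis using toric_ring_0 by auto
    next
      case False
      obtain u where u: "u \<in> lattice_cone Q"
        "Max (Poly_Mapping.keys f) = Max (Poly_Mapping.keys g) + u"
        using almost_integral_leading_exponent[OF Q False assms(5,6) less.prems] by blast
      \<comment> \<open>The quotient of the leading coefficients, chosen so that
        \<open>s * g\<close> cancels the leading term of \<open>f\<close>.\<close>
      define c where "c = Poly_Mapping.lookup f (Max (Poly_Mapping.keys f))
        / Poly_Mapping.lookup g (Max (Poly_Mapping.keys g))"
      define s where "s = Poly_Mapping.single u c"
      define f' where "f' = f - s * g"
      have s: "s \<in> toric_ring Q"
        using assms(4) u(1) by (auto simp: s_def toric_ring_eq integrally_decomposable_def)
      have "Max (Poly_Mapping.keys g) \<in> Poly_Mapping.keys g"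
        using assms(5) by (simp add: Max_in)
      then have lg: "Poly_Mapping.lookup g (Max (Poly_Mapping.keys g)) \<noteq> 0"
        by (simp add: in_keys_iff)
      have le: "e \<le> Max (Poly_Mapping.keys f)" if "e \<in> Poly_Mapping.keys f'" for e
      proof -
        from that have "e \<in> Poly_Mapping.keys f \<or> e \<in> Poly_Mapping.keys (s * g)"
          by (auto simp: f'_def in_keys_iff lookup_minus)
        moreover have "e \<le> Max (Poly_Mapping.keys f)" if sg: "e \<in> Poly_Mapping.keys (s * g)"
        proof -
          from sg obtain b where "e = u + b" "b \<in> Poly_Mapping.keys g"
            using keys_mult[of s g] by (auto simp: s_def split: if_splits)
          then have "u + b \<le> u + Max (Poly_Mapping.keys g)" by (intro add_left_mono) simp
          then show ?thesis unfolding u(2) \<open>e = u + b\<close> by (simp only: add.commute)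
        qed
        moreover have "e \<le> Max (Poly_Mapping.keys f)" if "e \<in> Poly_Mapping.keys f"
          using that by (simp add: Max_ge)
        ultimately show ?thesis by blast
      qed
      have "Poly_Mapping.lookup (s * g) (u + Max (Poly_Mapping.keys g)) =
          c * Poly_Mapping.lookup g (Max (Poly_Mapping.keys g))"
        by (subst lookup_mult_add_Max) (auto simp: s_def split: if_splits)
      then have "Poly_Mapping.lookup f' (Max (Poly_Mapping.keys f)) = 0"
        using lg by (simp add: f'_def lookup_minus c_def u(2) add.commute)
      then have notin: "Max (Poly_Mapping.keys f) \<notin> Poly_Mapping.keys f'"
        by (simp add: in_keys_iff)
      have "\<exists>h\<in>toric_ring Q. f' = h * g"
      proof (cases "f' = 0")
        case True
        then show ?thesis using toric_ring_0 by auto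
      next
        case f': False
        then have "Max (Poly_Mapping.keys f') \<in> Poly_Mapping.keys f'" by (simp add: Max_in)
        then have lt: "Max (Poly_Mapping.keys f') < Max (Poly_Mapping.keys f)"
          using le notin by (metis order_le_less)
        have "below f' \<subseteq> below f"
          using lt by (auto simp: below_def)
        \<comment> \<open>Adding \<open>u\<close> to the leading exponent of \<open>g\<close> gives
          exactly that of \<open>f\<close>, which is strictly above that of
          \<open>f'\<close>.\<close>
        moreover have "u \<in> below f - below f'"
          using lt u by (auto simp: below_def)
        ultimately have "card (below f') < card (below f)"
          by (intro psubset_card_mono fin) auto
        then show ?thesis
          by (rule less.hyps) (unfold f'_def, rule almost_integral_diff[OF less.prems s])
      qed
      then obtain h where h: "h \<in> toric_ring Q" "f - s * g = h * g"
        unfolding f'_def by blast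
      then have "f = (h + s) * g" by (simp only: diff_eq_eq distrib_right)
      then show ?thesis by (rule bexI) (rule toric_ring_add[OF h(1) s])
    qed
  qed
qed


subsection \<open>Normality and integer decomposition\<close>

lemma Fract_power:
  fixes a b :: "'a::idom"
  assumes "b \<noteq> 0"
  shows "Fraction_Field.Fract a b ^ n = Fraction_Field.Fract (a ^ n) (b ^ n)"
  using assms by (induction n) (simp_all add: One_fract_def)

lemma toric_fract_1: "Fraction_Field.Fract 1 1 \<in> subring_in_fract (toric_ring Q)"
  by (simp add: subring_in_fract_def toric_ring_1)

lemma toric_fract_mult:
  "x \<in> subring_in_fract (toric_ring Q) \<Longrightarrow> y \<in> subring_in_fract (toric_ring Q) \<Longrightarrow>
    x * y \<in> subring_in_fract (toric_ring Q)"
  by (auto simp: subring_in_fract_def intro!: imageI toric_ring_mult)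

lemma toric_fract_uminus:
  "x \<in> subring_in_fract (toric_ring Q) \<Longrightarrow> - x \<in> subring_in_fract (toric_ring Q)"
  by (auto simp: subring_in_fract_def intro!: imageI toric_ring_uminus)

lemma toric_fract_sum:
  "(\<And>i. i \<in> I \<Longrightarrow> f i \<in> subring_in_fract (toric_ring Q)) \<Longrightarrow>
    sum f I \<in> subring_in_fract (toric_ring Q)"
proof (induction I rule: infinite_finite_induct)
  case (insert i I)
  then have "f i \<in> subring_in_fract (toric_ring Q)" "sum f I \<in> subring_in_fract (toric_ring Q)"
    by auto
  then have "f i + sum f I \<in> subring_in_fract (toric_ring Q)"
    by (auto simp: subring_in_fract_def intro!: imageI toric_ring_add)
  then show ?case using insert by simp
qed (auto simp: subring_in_fract_def Zero_fract_def intro!: imageI toric_ring_0)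

text \<open>With \<open>m\<close> the degree of a monic equation for \<open>x = f / g\<close>, the
  factor \<open>g ^ m\<close> clears the denominators of all \<open>x ^ k\<close> with
  \<open>k < m\<close>. The equation expresses higher powers through lower ones, so the same factor
  serves for every \<open>k\<close>.\<close>

lemma integral_imp_almost_integral:
  fixes f g :: "('n::finite, 'k::field) laurent"
  assumes fg: "f \<in> toric_ring Q" "g \<in> toric_ring Q" "g \<noteq> 0"
    and int: "integral_over (subring_in_fract (toric_ring Q)) (Fraction_Field.Fract f g)"
  obtains m where "\<And>k. \<exists>h\<in>toric_ring Q. g ^ m * f ^ k = g ^ k * h"
proof -
  define R where "R = subring_in_fract (toric_ring Q :: ('n, 'k) laurent set)"
  define x where "x = Fraction_Field.Fract f g"
  obtain p where p: "lead_coeff p = 1" "\<And>i. coeff p i \<in> R" "poly p x = 0"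
    using int unfolding integral_over_def R_def x_def by blast
  define m where "m = degree p"
  have "0 = (\<Sum>i\<le>m. coeff p i * x ^ i)"
    using p(3) by (simp add: poly_altdef m_def)
  also have "\<dots> = (\<Sum>i<m. coeff p i * x ^ i) + x ^ m"
    using p(1) by (simp add: m_def flip: lessThan_Suc_atMost)
  finally have xm: "x ^ m = - (\<Sum>i<m. coeff p i * x ^ i)"
    by (simp add: eq_neg_iff_add_eq_0 add.commute)
  define D where "D = Fraction_Field.Fract (g ^ m) 1"
  have mem: "D * x ^ k \<in> R" for k
  proof (induction k rule: less_induct)
    case (less k)
    show ?case
    proof (cases "k < m")
      case True
      have "g ^ m = g ^ k * g ^ (m - k)"
        using True by (simp flip: power_add)
      then have "D * x ^ k = Fraction_Field.Fract (g ^ (m - k) * f ^ k) 1"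
        using fg(3) by (simp add: D_def x_def Fract_power eq_fract algebra_simps)
      then show ?thesis
        unfolding R_def subring_in_fract_def
        by (auto intro!: imageI toric_ring_mult toric_ring_power fg)
    next
      case False
      then have k: "x ^ k = x ^ (k - m) * x ^ m" by (simp flip: power_add)
      \<comment> \<open>Replacing the factor \<open>x ^ m\<close> leaves powers with exponents
        \<open>k - m + i\<close>, which are below \<open>k\<close> since
        \<open>i < m\<close>.\<close>
      have "D * x ^ k = - (\<Sum>i<m. coeff p i * (D * x ^ (k - m + i)))"
        unfolding k xm by (simp add: sum_distrib_left power_add mult_ac)
      also have "\<dots> \<in> R"
        unfolding R_def
      proof (rule toric_fract_uminus, rule toric_fract_sum, rule toric_fract_mult)
        fix i assume "i \<in> {..<m}"
        then show "coeff p i \<in> subring_in_fract (toric_ring Q)"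
          "D * x ^ (k - m + i) \<in> subring_in_fract (toric_ring Q)"
          using p(2) less[of "k - m + i"] False by (auto simp: R_def)
      qed
      finally show ?thesis .
    qed
  qed
  have "\<exists>h\<in>toric_ring Q. g ^ m * f ^ k = g ^ k * h" for k
  proof -
    obtain h where "h \<in> toric_ring Q" "D * x ^ k = Fraction_Field.Fract h 1"
      using mem[of k] unfolding R_def subring_in_fract_def by blast
    then show ?thesis
      using fg(3) by (auto simp: D_def x_def Fract_power eq_fract mult.commute)
  qed
  then show ?thesis by (rule that)
qed

lemma integrally_decomposable_imp_normal:
  assumes "compact Q" "convex Q" "Q \<noteq> {}" "integrally_decomposable Q"
  shows "normal_subring (toric_ring Q :: ('n::finite, 'k::field) laurent set)"
  unfolding normal_subring_def
proof (intro ballI impI)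
  fix x :: "('n, 'k) laurent fract"
  assume x: "x \<in> fraction_field_of (toric_ring Q)"
    and int: "integral_over (subring_in_fract (toric_ring Q)) x"
  obtain f g where fg: "x = Fraction_Field.Fract f g" "f \<in> toric_ring Q" "g \<in> toric_ring Q" "g \<noteq> 0"
    using x unfolding fraction_field_of_def by blast
  obtain m where "\<And>k. \<exists>h\<in>toric_ring Q. g ^ m * f ^ k = g ^ k * h"
    using integral_imp_almost_integral[OF fg(2-4)] int fg(1) by blast
  then obtain h where "h \<in> toric_ring Q" "f = h * g"
    using almost_integral_imp_multiple[OF assms fg(4), of "g ^ m" f] fg(4) by auto
  then have "x = Fraction_Field.Fract h 1"
    using fg by (simp add: eq_fract)
  then show "x \<in> subring_in_fract (toric_ring Q)"
    using \<open>h \<in> toric_ring Q\<close> by (simp add: subring_in_fract_def)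
qed

section \<open>From normality to integer decomposition\<close>

lemma decomposable_sum:
  "(\<And>i. i \<in> I \<Longrightarrow> f i \<in> decomposable Q) \<Longrightarrow> sum f I \<in> decomposable Q"
  by (induction I rule: infinite_finite_induct) (auto intro: decomposable_add)

lemma t_expo_sum: "t_expo (sum f I) = (\<Sum>i\<in>I. t_expo (f i))"
  and s_expo_sum: "s_expo (sum f I) = (\<Sum>i\<in>I. s_expo (f i))"
  by (induction I rule: infinite_finite_induct) auto

lemma decomposable_scale:
  assumes "emb a \<in> Q"
  shows "Expo (\<chi> i. int n * a $ i) n \<in> decomposable Q"
proof -
  have "Expo (\<chi> i. int n * a $ i) n = (\<Sum>_<n. Expo a 1)"
    by (induction n) (simp_all add: expo_eq_iff vec_eq_iff algebra_simps del: sum_constant)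
  then show ?thesis
    by (simp add: assms decomposable_sum decomposable_point del: sum_constant One_nat_def)
qed

lemma lattice_polytope_vertices:
  fixes Q :: "(real ^ 'n::finite) set"
  assumes "lattice_polytope Q"
  obtains V where "finite V" "Q = convex hull (emb ` V)"
proof -
  define E where "E = {v. v extreme_point_of Q}"
  have Q: "polytope Q" using assms by (simp add: lattice_polytope_def)
  have E: "finite E" "Q = convex hull E"
    using finite_polyhedron_extreme_points[OF polytope_imp_polyhedron[OF Q]]
      Krein_Milman_Minkowski[OF polytope_imp_compact[OF Q] polytope_imp_convex[OF Q]]
    by (auto simp: E_def)
  \<comment> \<open>Extreme points are integral, so the floor merely moves them to the type of
    integer vectors.\<close>
  define r where "r = (\<lambda>v :: real ^ 'n. \<chi> i. \<lfloor>v $ i\<rfloor>)"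
  have "emb (r v) = v" if "v \<in> E" for v
    using that assms by (auto simp: r_def vec_eq_iff E_def lattice_polytope_def)
  then have "emb ` r ` E = E" by (force simp: image_image)
  then show ?thesis using E by (intro that[of "r ` E"]) auto
qed

text \<open>Rounding down the coefficients in a convex representation of \<open>m e\<close> leaves a remainder that
  takes only finitely many values, so it agrees for two different values of \<open>m\<close>.\<close>

lemma lattice_cone_multiple_decomposable:
  fixes Q :: "(real ^ 'n::finite) set"
  assumes "lattice_polytope Q" "e \<in> lattice_cone Q"
  obtains M where "M > 0" "Expo (\<chi> i. int M * t_expo e $ i) (M * s_expo e) \<in> decomposable Q"
proof -
  obtain V where V: "finite V" "Q = convex hull (emb ` V)"
    using lattice_polytope_vertices[OF assms(1)] .
  obtain q where q: "q \<in> Q" "emb (t_expo e) = real (s_expo e) *\<^sub>R q"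
    using assms(2) by (auto simp: lattice_cone_def)
  have inj: "inj_on emb V" by (auto simp: inj_on_def vec_eq_iff)
  obtain w where w: "\<And>v. v \<in> V \<Longrightarrow> w v \<ge> 0" "sum w V = 1" "(\<Sum>v\<in>V. w v *\<^sub>R emb v) = q"
  proof -
    obtain u where "\<forall>x\<in>emb ` V. 0 \<le> u x" "sum u (emb ` V) = 1" "(\<Sum>x\<in>emb ` V. u x *\<^sub>R x) = q"
      using q(1) V by (auto simp: convex_hull_finite)
    then show ?thesis
      by (intro that[of "u \<circ> emb"]) (auto simp: sum.reindex[OF inj])
  qed
  \<comment> \<open>With these weights \<open>e\<close> is the combination of the points
    \<open>(v, 1)\<close>, in both the \<open>t\<close> and the \<open>s\<close> component.\<close>
  define \<mu> where "\<mu> = (\<lambda>v. real (s_expo e) * w v)"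
  have \<mu>: "\<And>v. v \<in> V \<Longrightarrow> \<mu> v \<ge> 0" "sum \<mu> V = real (s_expo e)"
    using w by (auto simp: \<mu>_def simp flip: sum_distrib_left)
  have te: "real_of_int (t_expo e $ i) = (\<Sum>v\<in>V. \<mu> v * real_of_int (v $ i))" for i
  proof -
    have "real_of_int (t_expo e $ i) = real (s_expo e) * q $ i"
      using arg_cong[OF q(2), of "\<lambda>x. x $ i"] by simp
    also have "q $ i = (\<Sum>v\<in>V. w v * real_of_int (v $ i))"
      by (simp flip: w(3))
    finally show ?thesis by (simp add: \<mu>_def sum_distrib_left mult.assoc)
  qed
  define n where "n = (\<lambda>m v. \<lfloor>real m * \<mu> v\<rfloor>)"
  \<comment> \<open>The \<open>t\<close> and \<open>s\<close> components of the remainder; both are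
    combinations of the \<open>v\<close> and of 1 with fractional parts as coefficients, hence
    bounded independently of \<open>m\<close>.\<close>
  define rt where "rt = (\<lambda>m. \<chi> i. int m * t_expo e $ i - (\<Sum>v\<in>V. n m v * v $ i))"
  define rs where "rs = (\<lambda>m. int m * int (s_expo e) - (\<Sum>v\<in>V. n m v))"
  define B where "B = (\<Sum>v\<in>V. \<Sum>i\<in>UNIV. \<bar>v $ i\<bar>)"
  have frac: "real m * \<mu> v - real_of_int (n m v) = frac (real m * \<mu> v)" for m v
    by (simp add: n_def frac_def)
  have rt: "rt m $ i \<in> {-B..B}" for m i
  proof -
    have "real_of_int (rt m $ i) = (\<Sum>v\<in>V. frac (real m * \<mu> v) * real_of_int (v $ i))"
      by (simp add: rt_def te sum_distrib_left left_diff_distrib mult.assoc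
          flip: frac sum_subtractf)
    then have "\<bar>real_of_int (rt m $ i)\<bar> \<le> (\<Sum>v\<in>V. \<bar>frac (real m * \<mu> v) * real_of_int (v $ i)\<bar>)"
      by (simp add: sum_abs)
    also have "\<dots> \<le> (\<Sum>v\<in>V. real_of_int \<bar>v $ i\<bar>)"
      by (intro sum_mono)
        (auto simp: abs_mult frac_ge_0 less_imp_le[OF frac_lt_1] intro!: mult_left_le_one_le)
    also have "\<dots> \<le> real_of_int B"
      unfolding B_def of_int_sum
      by (intro sum_mono member_le_sum[where f = "\<lambda>i. real_of_int \<bar>_ $ i\<bar>"]) auto
    finally have "\<bar>rt m $ i\<bar> \<le> B" by linarith
    then show ?thesis by auto
  qed
  have rs: "rs m \<in> {0..int (card V)}" for m
  proof -
    have "real_of_int (rs m) = (\<Sum>v\<in>V. frac (real m * \<mu> v))"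
      by (simp add: rs_def sum_distrib_left flip: frac sum_subtractf \<mu>(2))
    moreover have "0 \<le> (\<Sum>v\<in>V. frac (real m * \<mu> v))"
      by (intro sum_nonneg) (simp add: frac_ge_0)
    moreover have "(\<Sum>v\<in>V. frac (real m * \<mu> v)) \<le> real (card V) * 1"
      by (intro sum_bounded_above) (simp add: less_imp_le[OF frac_lt_1])
    ultimately show ?thesis by auto
  qed
  have "(\<lambda>m. (rt m, rs m)) ` UNIV \<subseteq> {a. \<forall>i. a $ i \<in> {-B..B}} \<times> {0..int (card V)}"
    using rt rs by blast
  then have "finite (range (\<lambda>m. (rt m, rs m)))"
    by (rule finite_subset) (intro finite_cartesian_product finite_vec_of_finite; simp)
  then have "\<not> inj (\<lambda>m. (rt m, rs m))"
    using finite_imageD infinite_UNIV_nat by blast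
  then obtain m1 m2 where m: "m1 < m2" "rt m1 = rt m2" "rs m1 = rs m2"
    unfolding inj_def by (metis linorder_neqE_nat prod.inject)
  define M where "M = m2 - m1"
  \<comment> \<open>Equal remainders cancel, so \<open>(m2 - m1) e\<close> is the combination of the
    \<open>(v, 1)\<close> with these coefficients. The floors grow with \<open>m\<close>, so
    \<open>nat\<close> loses nothing.\<close>
  define c where "c = (\<lambda>v. nat (n m2 v - n m1 v))"
  have c: "int (c v) = n m2 v - n m1 v" if "v \<in> V" for v
    using \<mu>(1)[OF that] m(1) by (simp add: c_def n_def floor_mono mult_right_mono)
  have "Expo (\<chi> i. int M * t_expo e $ i) (M * s_expo e)
      = (\<Sum>v\<in>V. Expo (\<chi> i. int (c v) * v $ i) (c v))"
  proof -
    have "int M * t_expo e $ i = (\<Sum>v\<in>V. int (c v) * v $ i)" for i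
    proof -
      have "(\<Sum>v\<in>V. int (c v) * v $ i) = (\<Sum>v\<in>V. n m2 v * v $ i) - (\<Sum>v\<in>V. n m1 v * v $ i)"
        by (simp add: c left_diff_distrib sum_subtractf)
      also have "\<dots> = int m2 * t_expo e $ i - int m1 * t_expo e $ i"
        using arg_cong[OF m(2), of "\<lambda>x. x $ i"] by (simp add: rt_def)
      finally show ?thesis using m(1) by (simp add: M_def of_nat_diff left_diff_distrib)
    qed
    moreover have "M * s_expo e = (\<Sum>v\<in>V. c v)"
    proof -
      have "int (\<Sum>v\<in>V. c v) = (\<Sum>v\<in>V. n m2 v) - (\<Sum>v\<in>V. n m1 v)"
        by (simp add: c sum_subtractf)
      also have "\<dots> = int m2 * int (s_expo e) - int m1 * int (s_expo e)"
        using m(3) by (simp add: rs_def)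
      also have "\<dots> = int (M * s_expo e)"
        using m(1) by (simp add: M_def of_nat_diff left_diff_distrib)
      finally show ?thesis by linarith
    qed
    ultimately show ?thesis
      by (simp add: expo_eq_iff t_expo_sum s_expo_sum vec_eq_iff)
  qed
  moreover have "emb v \<in> Q" if "v \<in> V" for v
    using that V(2) hull_subset[of "emb ` V" convex] by auto
  ultimately have "Expo (\<chi> i. int M * t_expo e $ i) (M * s_expo e) \<in> decomposable Q"
    using decomposable_sum[of V "\<lambda>v. Expo (\<chi> i. int (c v) * v $ i) (c v)"] decomposable_scale
    by metis
  moreover have "M > 0" using m(1) by (simp add: M_def)
  ultimately show ?thesis using that by blast
qed

text \<open>The monoid generates the full lattice as a group: unit vectors produce the positive and
  negative parts of \<open>t_expo e\<close>, and copies of the origin adjust the exponent of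
  \<open>s\<close>.\<close>

lemma expo_difference_decomposable:
  fixes Q :: "(real ^ 'n::finite) set"
  assumes "0 \<in> Q" "\<And>i. axis i 1 \<in> Q"
  obtains a b where "a \<in> decomposable Q" "b \<in> decomposable Q" "e + a = b"
proof -
  have ax: "emb (axis i 1) \<in> Q" for i :: 'n
  proof -
    have "emb (axis i 1) = axis i 1" by (simp add: vec_eq_iff axis_def)
    then show ?thesis using assms(2) by simp
  qed
  have z: "Expo 0 k \<in> decomposable Q" for k
  proof -
    have "(0 :: int ^ 'n) = (\<chi> i. int k * 0 $ i)" by (simp add: vec_eq_iff)
    with decomposable_scale[of 0 Q k] assms(1) show ?thesis by simp
  qed
  \<comment> \<open>\<open>nat\<close> sends negative coordinates to 0, so \<open>p c\<close>
    represents the positive part of \<open>c\<close>.\<close>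
  define p where "p = (\<lambda>c :: int ^ 'n. \<Sum>i\<in>UNIV.
    Expo (\<chi> j. int (nat (c $ i)) * axis i 1 $ j) (nat (c $ i)))"
  have p: "p c \<in> decomposable Q" for c
    unfolding p_def by (intro decomposable_sum decomposable_scale ax)
  have tp: "t_expo (p c) $ j = max 0 (c $ j)" for c j
  proof -
    have "t_expo (p c) $ j = (\<Sum>i\<in>UNIV. if i = j then max 0 (c $ j) else 0)"
      unfolding p_def t_expo_sum sum_component by (intro sum.cong) (auto simp: axis_def)
    then show ?thesis by simp
  qed
  define t where "t = t_expo e"
  have "e + (p (- t) + Expo 0 (s_expo (p t))) = p t + Expo 0 (s_expo e + s_expo (p (- t)))"
    by (auto simp: expo_eq_iff vec_eq_iff tp t_def)
  then show ?thesis
    using that decomposable_add p z by blast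
qed

text \<open>The monomial with exponent \<open>e\<close> is a quotient of two monomials of the ring,
  and some positive power of it lies in the ring, so it is integral. Normality puts it into the
  ring, which means that \<open>e\<close> is decomposable.\<close>

lemma normal_imp_integrally_decomposable:
  assumes "lattice_polytope Q" "0 \<in> Q" "\<And>i. axis i 1 \<in> Q"
    and "normal_subring (toric_ring Q :: ('n::finite, 'k::field) laurent set)"
  shows "integrally_decomposable Q"
  unfolding integrally_decomposable_def
proof
  fix e :: "'n expo" assume e: "e \<in> lattice_cone Q"
  define X where "X = (\<lambda>e. Poly_Mapping.single e 1 :: ('n, 'k) laurent)"
  have X_mult: "X a * X b = X (a + b)" for a b by (simp add: X_def mult_single)
  have X_mem: "X a \<in> toric_ring Q \<longleftrightarrow> a \<in> decomposable Q" for a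
    by (simp add: X_def toric_ring_eq)
  have X_0: "X a \<noteq> 0" for a
    using inj_single[of a] unfolding X_def by (metis keys_single keys_zero insert_not_empty zero_neq_one)
  have X_power: "X e ^ n = X (Expo (\<chi> i. int n * t_expo e $ i) (n * s_expo e))" for n
  proof (induction n)
    case 0
    then show ?case by (simp add: X_def zero_expo_def zero_vec_def flip: single_one)
  next
    case (Suc n)
    then show ?case
      by (simp add: X_mult) (rule arg_cong[where f = X], simp add: expo_eq_iff vec_eq_iff algebra_simps)
  qed
  define x where "x = Fraction_Field.Fract (X e) 1"
  obtain a b where ab: "a \<in> decomposable Q" "b \<in> decomposable Q" "e + a = b"
    using expo_difference_decomposable[OF assms(2,3)] by blast
  have "x = Fraction_Field.Fract (X b) (X a)"
    using X_0 by (simp add: x_def eq_fract X_mult ab(3))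
  then have "x \<in> fraction_field_of (toric_ring Q)"
    unfolding fraction_field_of_def using ab X_mem X_0 by blast
  moreover have "integral_over (subring_in_fract (toric_ring Q)) x"
  proof -
    obtain M where M: "M > 0" "Expo (\<chi> i. int M * t_expo e $ i) (M * s_expo e) \<in> decomposable Q"
      using lattice_cone_multiple_decomposable[OF assms(1) e] .
    define c where "c = Fraction_Field.Fract (X e ^ M) 1"
    have c: "c \<in> subring_in_fract (toric_ring Q)"
      using M(2) by (simp add: c_def subring_in_fract_def X_power X_mem)
    \<comment> \<open>The polynomial \<open>Y^M - c\<close>; since \<open>M > 0\<close>, the
      constant term does not disturb the leading coefficient.\<close>
    define p where "p = monom 1 M + [:- c:]"
    have "degree p = M"
      unfolding p_def using M(1)
      by (simp add: degree_add_eq_left degree_monom_eq)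
    then have "lead_coeff p = 1"
      using M(1) by (simp add: p_def coeff_pCons split: nat.split)
    moreover have "coeff p i \<in> subring_in_fract (toric_ring Q)" for i
    proof -
      have "coeff p i \<in> {0, 1, - c}"
        using M(1) by (auto simp: p_def coeff_pCons split: nat.split)
      moreover have "0 \<in> subring_in_fract (toric_ring Q :: ('n, 'k) laurent set)"
        using toric_fract_sum[of "{}"] by simp
      ultimately show ?thesis
        using toric_fract_uminus[OF c] toric_fract_1[of Q] by (auto simp: One_fract_def)
    qed
    moreover have "poly p x = 0"
      by (simp add: p_def poly_monom x_def c_def Fract_power Zero_fract_def)
    ultimately show ?thesis unfolding integral_over_def by blast
  qed
  ultimately have "x \<in> subring_in_fract (toric_ring Q)"
    using assms(4) unfolding normal_subring_def by blast
  then obtain r where "r \<in> toric_ring Q" "x = Fraction_Field.Fract r 1"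
    unfolding subring_in_fract_def by blast
  then have "X e \<in> toric_ring Q"
    by (simp add: x_def eq_fract)
  then show "e \<in> decomposable Q" by (simp add: X_mem)
qed


lemma normal_iff_integrally_decomposable:
  assumes "lattice_polytope Q" "0 \<in> Q" "\<And>i. axis i 1 \<in> Q"
  shows "normal_subring (toric_ring Q :: ('n::finite, 'k::field) laurent set) \<longleftrightarrow>
    integrally_decomposable Q"
proof
  have "polytope Q" using assms(1) by (simp add: lattice_polytope_def)
  moreover assume "integrally_decomposable Q"
  ultimately show "normal_subring (toric_ring Q :: ('n, 'k) laurent set)"
    using assms(2)
    by (intro integrally_decomposable_imp_normal polytope_imp_compact polytope_imp_convex) auto
qed (rule normal_imp_integrally_decomposable[OF assms])

subsection \<open>Anti-blocking pieces\<close>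

lemma lattice_coneI:
  "q \<in> Q \<Longrightarrow> emb t = real s *\<^sub>R q \<Longrightarrow> Expo t s \<in> lattice_cone Q"
  by (auto simp: lattice_cone_def)

lemma anti_blocking_downward:
  assumes "anti_blocking Q" "y \<in> Q" "\<And>i. 0 \<le> x $ i" "\<And>i. x $ i \<le> y $ i"
  shows "x \<in> Q"
  using assms unfolding anti_blocking_def by blast

lemma anti_blocking_nonneg: "anti_blocking Q \<Longrightarrow> y \<in> Q \<Longrightarrow> 0 \<le> y $ i"
  by (auto simp: anti_blocking_def nonneg_orthant_def)

text \<open>By full dimension some lattice point of \<open>Q\<close> has a nonzero coordinate
  \<open>i\<close>. It is nonnegative and integral, hence at least 1, and the unit vector lies below
  this point.\<close>

lemma anti_blocking_axis:
  assumes "anti_blocking (Q :: (real ^ 'n) set)"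
  shows "axis i 1 \<in> Q"
proof -
  have "lattice_polytope Q" using assms by (simp add: anti_blocking_def)
  then obtain V where V: "Q = convex hull (emb ` V)"
    by (rule lattice_polytope_vertices)
  have "\<exists>v\<in>V. v $ i \<noteq> 0"
  proof (rule ccontr)
    assume "\<not> ?thesis"
    then have "emb ` V \<subseteq> {x. axis i 1 \<bullet> x = 0}"
      by (auto simp: inner_axis')
    then have "Q \<subseteq> {x. axis i 1 \<bullet> x = 0}"
      unfolding V by (rule hull_minimal) (rule convex_hyperplane)
    then have "aff_dim Q \<le> aff_dim {x :: real ^ 'n. axis i 1 \<bullet> x = 0}"
      by (rule aff_dim_subset)
    also have "\<dots> = int CARD('n) - 1"
      by (subst aff_dim_hyperplane) (simp_all add: axis_eq_0_iff)
    finally show False using assms by (simp add: anti_blocking_def)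
  qed
  then obtain v where v: "v \<in> V" "v $ i \<noteq> 0" by blast
  have vQ: "emb v \<in> Q" using v(1) unfolding V by (intro hull_inc) auto
  have nonneg: "0 \<le> v $ j" for j using anti_blocking_nonneg[OF assms vQ, of j] by simp
  show ?thesis
  proof (rule anti_blocking_downward[OF assms vQ])
    fix j
    have "1 \<le> v $ i" using nonneg[of i] v(2) by simp
    then show "axis i 1 $ j \<le> emb v $ j"
      using nonneg[of j] by (cases "j = i") (simp_all add: axis_def)
  qed (simp add: axis_def)
qed

lemma anti_blocking_0:
  assumes "anti_blocking (Q :: (real ^ 'n) set)"
  shows "0 \<in> Q"
  by (rule anti_blocking_downward[OF assms anti_blocking_axis[OF assms]]) (auto simp: axis_def)

section \<open>Reflections by sign vectors\<close>

lemma sign_vectors_cases: "\<epsilon> \<in> sign_vectors \<Longrightarrow> \<epsilon> $ i = 1 \<or> \<epsilon> $ i = -1"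
  by (auto simp: sign_vectors_def)

lemma sign_act_nth [simp]: "sign_act \<epsilon> x $ i = \<epsilon> $ i * x $ i"
  by (simp add: sign_act_def)

lemma sign_act_sign_act:
  assumes "\<epsilon> \<in> sign_vectors"
  shows "sign_act \<epsilon> (sign_act \<epsilon> x) = x"
  unfolding vec_eq_iff
proof
  fix i show "sign_act \<epsilon> (sign_act \<epsilon> x) $ i = x $ i"
    using sign_vectors_cases[OF assms, of i] by auto
qed

lemma mem_piece_iff:
  assumes "anti_blocking_piece P \<epsilon> Q" "\<epsilon> \<in> sign_vectors" "x \<in> orthant \<epsilon>"
  shows "x \<in> P \<longleftrightarrow> sign_act \<epsilon> x \<in> Q"
proof -
  have "x \<in> P \<longleftrightarrow> x \<in> pm_closure Q"
    using assms(1,3) unfolding anti_blocking_piece_def by blast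
  also have "\<dots> \<longleftrightarrow> sign_act \<epsilon> x \<in> Q"
  proof
    assume "x \<in> pm_closure Q"
    then obtain \<delta> y where y: "x = sign_act \<delta> y" "\<delta> \<in> sign_vectors" "y \<in> Q"
      by (auto simp: pm_closure_def)
    \<comment> \<open>The signs \<open>\<delta>\<close> and \<open>\<epsilon>\<close> can differ
      only where \<open>x\<close> vanishes; both sides are the absolute value of
      \<open>x $ i\<close>.\<close>
    have "\<epsilon> $ i * x $ i = y $ i" for i
      using anti_blocking_nonneg[of Q y i] assms(1) y sign_vectors_cases[OF y(2), of i]
        sign_vectors_cases[OF assms(2), of i] assms(3)
      by (auto simp: anti_blocking_piece_def orthant_def dest!: spec[of _ i])
    then have "sign_act \<epsilon> x = y" by (simp add: vec_eq_iff)
    then show "sign_act \<epsilon> x \<in> Q" using y(3) by simp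
  next
    assume "sign_act \<epsilon> x \<in> Q"
    then show "x \<in> pm_closure Q"
      using sign_act_sign_act[OF assms(2), of x] assms(2) unfolding pm_closure_def
      by (metis (mono_tags, lifting) mem_Collect_eq)
  qed
  finally show ?thesis .
qed

lemma sign_act_mem_orthant:
  assumes "\<epsilon> \<in> sign_vectors" "\<And>i. 0 \<le> y $ i"
  shows "sign_act \<epsilon> y \<in> orthant \<epsilon>"
  unfolding orthant_def
proof (intro CollectI allI)
  fix i show "0 \<le> sign_act \<epsilon> y $ i * \<epsilon> $ i"
    using sign_vectors_cases[OF assms(1), of i] assms(2)[of i] by auto
qed

lemma sign_act_piece_mem:
  assumes "anti_blocking_piece P \<epsilon> Q" "\<epsilon> \<in> sign_vectors" "y \<in> Q"
  shows "sign_act \<epsilon> y \<in> P"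
proof -
  have "sign_act \<epsilon> y \<in> orthant \<epsilon>"
    using assms by (intro sign_act_mem_orthant) (auto simp: anti_blocking_piece_def anti_blocking_nonneg)
  then show ?thesis
    using mem_piece_iff[OF assms(1,2)] assms(3) sign_act_sign_act[OF assms(2)] by metis
qed

text \<open>The integer counterpart of \<open>sign_act\<close>. The signs are real numbers, so a
  case distinction replaces the product.\<close>

definition int_sign_act :: "real ^ 'n \<Rightarrow> int ^ 'n \<Rightarrow> int ^ 'n" where
  "int_sign_act \<epsilon> a = (\<chi> i. if \<epsilon> $ i = 1 then a $ i else - a $ i)"

lemma int_sign_act_add: "int_sign_act \<epsilon> (a + b) = int_sign_act \<epsilon> a + int_sign_act \<epsilon> b"
  by (simp add: int_sign_act_def vec_eq_iff)

lemma int_sign_act_0: "int_sign_act \<epsilon> 0 = 0"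
  by (simp add: int_sign_act_def vec_eq_iff)

lemma emb_int_sign_act:
  assumes "\<epsilon> \<in> sign_vectors"
  shows "emb (int_sign_act \<epsilon> a) = sign_act \<epsilon> (emb a)"
  unfolding vec_eq_iff
proof
  fix i show "emb (int_sign_act \<epsilon> a) $ i = sign_act \<epsilon> (emb a) $ i"
    using sign_vectors_cases[OF assms, of i] by (auto simp: int_sign_act_def)
qed

lemma int_sign_act_int_sign_act:
  assumes "\<epsilon> \<in> sign_vectors"
  shows "int_sign_act \<epsilon> (int_sign_act \<epsilon> a) = a"
  unfolding vec_eq_iff
proof
  fix i show "int_sign_act \<epsilon> (int_sign_act \<epsilon> a) $ i = a $ i"
    using sign_vectors_cases[OF assms, of i] by (auto simp: int_sign_act_def)
qed

lemma obtain_orthant: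
  obtains \<epsilon> :: "real ^ 'n" where "\<epsilon> \<in> sign_vectors" "x \<in> orthant \<epsilon>"
    "\<And>i. \<epsilon> $ i = (if 0 \<le> x $ i then 1 else -1)"
  by (rule that[of "\<chi> i. if 0 \<le> x $ i then 1 else -1"]) (auto simp: sign_vectors_def orthant_def)

section \<open>Integer decomposition for the polytope and its pieces\<close>

text \<open>The orthant of \<open>q\<close> selects the piece. Reflection is additive and maps
  lattice points of the piece into \<open>P\<close>, so it carries a decomposition back.\<close>

lemma integrally_decomposable_of_pieces:
  fixes P :: "(real ^ 'n::finite) set"
  assumes piece: "\<And>\<epsilon>. \<epsilon> \<in> sign_vectors \<Longrightarrow> anti_blocking_piece P \<epsilon> (Pe \<epsilon>)"
    and dec: "\<And>\<epsilon>. \<epsilon> \<in> sign_vectors \<Longrightarrow> integrally_decomposable (Pe \<epsilon>)"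
  shows "integrally_decomposable P"
  unfolding integrally_decomposable_def
proof
  fix e :: "'n expo" assume "e \<in> lattice_cone P"
  then obtain q where q: "q \<in> P" "emb (t_expo e) = real (s_expo e) *\<^sub>R q"
    by (auto simp: lattice_cone_def)
  obtain \<epsilon> :: "real ^ 'n" where \<epsilon>: "\<epsilon> \<in> sign_vectors" "q \<in> orthant \<epsilon>"
    using obtain_orthant by blast
  have refl: "Expo (int_sign_act \<epsilon> (t_expo f)) (s_expo f) \<in> decomposable P"
    if "f \<in> decomposable (Pe \<epsilon>)" for f
    using that
  proof (induction rule: decomposable_induct)
    case zero
    then show ?case using decomposable_0 by (simp add: int_sign_act_0 flip: zero_expo_def)
  next
    case (add a f)
    have "Expo (int_sign_act \<epsilon> a) 1 \<in> decomposable P"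
      using sign_act_piece_mem[OF piece[OF \<epsilon>(1)] \<epsilon>(1) add(1)]
      by (intro decomposable_point) (simp add: emb_int_sign_act \<epsilon>(1))
    from decomposable_add[OF this add(3)] show ?case
      by (simp add: int_sign_act_add plus_expo_def)
  qed
  have "sign_act \<epsilon> q \<in> Pe \<epsilon>"
    using mem_piece_iff[OF piece[OF \<epsilon>(1)] \<epsilon>] q(1) by simp
  moreover have "emb (int_sign_act \<epsilon> (t_expo e)) = real (s_expo e) *\<^sub>R sign_act \<epsilon> q"
    by (simp add: emb_int_sign_act \<epsilon>(1) q(2) vec_eq_iff)
  ultimately have "Expo (int_sign_act \<epsilon> (t_expo e)) (s_expo e) \<in> decomposable (Pe \<epsilon>)"
    using dec[OF \<epsilon>(1)] lattice_coneI unfolding integrally_decomposable_def by blast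
  from refl[OF this] show "e \<in> decomposable P"
    by (simp add: int_sign_act_int_sign_act \<epsilon>(1))
qed

lemma decomposable_downward:
  fixes Q :: "(real ^ 'n::finite) set"
  assumes Q: "anti_blocking Q" and "f \<in> decomposable Q"
    and "\<And>i. 0 \<le> t $ i" "\<And>i. t $ i \<le> t_expo f $ i"
  shows "Expo t (s_expo f) \<in> decomposable Q"
proof -
  \<comment> \<open>Nonnegativity is carried along because \<open>t - b\<close> below vanishes
    wherever \<open>b\<close> takes the value of \<open>t\<close>, and must still be bounded by
    \<open>t_expo f\<close> there.\<close>
  have "(\<forall>i. 0 \<le> t_expo f $ i) \<and> (\<forall>t. (\<forall>i. 0 \<le> t $ i \<and> t $ i \<le> t_expo f $ i) \<longrightarrow>
      Expo t (s_expo f) \<in> decomposable Q)"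
    using assms(2)
  proof (induction rule: decomposable_induct)
    case zero
    have "t = 0" if "\<forall>i. 0 \<le> t $ i \<and> t $ i \<le> t_expo 0 $ i" for t :: "int ^ 'n"
      using that by (simp add: vec_eq_iff order_antisym)
    then show ?case using decomposable_0[of Q] by (force simp: zero_expo_def)
  next
    case (add a f)
    have a: "0 \<le> a $ i" for i
      using anti_blocking_nonneg[OF Q add(1), of i] by simp
    have "Expo t (s_expo (Expo a 1 + f)) \<in> decomposable Q"
      if t: "\<forall>i. 0 \<le> t $ i \<and> t $ i \<le> t_expo (Expo a 1 + f) $ i" for t
    proof -
      \<comment> \<open>Greedy choice: the summand \<open>a\<close> absorbs as much of
        \<open>t\<close> as it can, and the rest stays below \<open>f\<close>.\<close>
      define b where "b = (\<chi> i. min (t $ i) (a $ i))"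
      have "emb b \<in> Q"
        by (rule anti_blocking_downward[OF Q add(1)]) (use t a in \<open>auto simp: b_def\<close>)
      moreover have "0 \<le> (t - b) $ i \<and> (t - b) $ i \<le> t_expo f $ i" for i
        using t a add(3) by (auto simp: b_def min_def algebra_simps)
      ultimately have "Expo b 1 + Expo (t - b) (s_expo f) \<in> decomposable Q"
        using add(3) by (intro decomposable_add decomposable_point) auto
      then show ?thesis by (simp add: plus_expo_def)
    qed
    moreover have "\<forall>i. 0 \<le> t_expo (Expo a 1 + f) $ i" using a add(3) by simp
    ultimately show ?case by blast
  qed
  then show ?thesis using assms(3,4) by blast
qed

text \<open>Setting to 0 the coordinates whose sign disagrees with \<open>\<epsilon>\<close> keeps
  \<open>x\<close> in \<open>P\<close>, because the piece of its own orthant \<open>\<delta>\<close>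
  is anti-blocking. The resulting \<open>y\<close> lies in both orthants, so it can be read in the
  piece of \<open>\<epsilon>\<close>.\<close>

lemma positive_part_mem_piece:
  assumes piece: "\<And>\<epsilon>. \<epsilon> \<in> sign_vectors \<Longrightarrow> anti_blocking_piece P \<epsilon> (Pe \<epsilon>)"
    and \<epsilon>: "\<epsilon> \<in> sign_vectors" and "x \<in> P"
  shows "(\<chi> i. max 0 (\<epsilon> $ i * x $ i)) \<in> Pe \<epsilon>"
proof -
  obtain \<delta> where \<delta>: "\<delta> \<in> sign_vectors" "x \<in> orthant \<delta>" "\<And>i. \<delta> $ i = (if 0 \<le> x $ i then 1 else -1)"
    using obtain_orthant[of x] by blast
  have pieces: "anti_blocking (Pe \<delta>)"
    using piece[OF \<delta>(1)] by (simp add: anti_blocking_piece_def)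
  define y where "y = (\<chi> i. if 0 \<le> \<epsilon> $ i * x $ i then x $ i else 0)"
  have mem: "sign_act \<delta> x \<in> Pe \<delta>"
    using mem_piece_iff[OF piece[OF \<delta>(1)] \<delta>(1,2)] assms(3) by simp
  have "sign_act \<delta> y \<in> Pe \<delta>"
    by (rule anti_blocking_downward[OF pieces mem]) (auto simp: y_def \<delta>(3))
  moreover have "y \<in> orthant \<delta>" "y \<in> orthant \<epsilon>"
    by (auto simp: orthant_def y_def \<delta>(3) mult.commute)
  ultimately have "sign_act \<epsilon> y \<in> Pe \<epsilon>"
    using mem_piece_iff[OF piece[OF \<delta>(1)] \<delta>(1)] mem_piece_iff[OF piece[OF \<epsilon>] \<epsilon>] by blast
  moreover have "sign_act \<epsilon> y = (\<chi> i. max 0 (\<epsilon> $ i * x $ i))"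
    by (auto simp: vec_eq_iff y_def)
  ultimately show ?thesis by simp
qed

text \<open>A decomposition in \<open>P\<close> may use summands outside the orthant of
  \<open>\<epsilon>\<close>. Their positive parts lie in the piece, and
  \<open>decomposable_downward\<close> trims the excess of the new sum.\<close>

lemma integrally_decomposable_piece:
  fixes P :: "(real ^ 'n::finite) set"
  assumes piece: "\<And>\<epsilon>. \<epsilon> \<in> sign_vectors \<Longrightarrow> anti_blocking_piece P \<epsilon> (Pe \<epsilon>)"
    and \<epsilon>: "\<epsilon> \<in> sign_vectors" and "integrally_decomposable P"
  shows "integrally_decomposable (Pe \<epsilon>)"
  unfolding integrally_decomposable_def
proof
  fix e :: "'n expo" assume "e \<in> lattice_cone (Pe \<epsilon>)"
  then obtain q where q: "q \<in> Pe \<epsilon>" "emb (t_expo e) = real (s_expo e) *\<^sub>R q"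
    by (auto simp: lattice_cone_def)
  have Q: "anti_blocking (Pe \<epsilon>)"
    using piece[OF \<epsilon>] by (simp add: anti_blocking_piece_def)
  have dominated: "\<exists>g\<in>decomposable (Pe \<epsilon>). s_expo g = s_expo f \<and>
      (\<forall>i. int_sign_act \<epsilon> (t_expo f) $ i \<le> t_expo g $ i)"
    if "f \<in> decomposable P" for f
    using that
  proof (induction rule: decomposable_induct)
    case zero
    show ?case by (rule bexI[OF _ decomposable_0]) (simp add: int_sign_act_0)
  next
    case (add a f)
    then obtain g where g: "g \<in> decomposable (Pe \<epsilon>)" "s_expo g = s_expo f"
      "\<And>i. int_sign_act \<epsilon> (t_expo f) $ i \<le> t_expo g $ i" by blast
    define b where "b = (\<chi> i. max 0 (int_sign_act \<epsilon> a $ i))"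
    have "emb b = (\<chi> i. max 0 (\<epsilon> $ i * emb a $ i))"
    proof -
      have "real_of_int (int_sign_act \<epsilon> a $ i) = \<epsilon> $ i * emb a $ i" for i
        using arg_cong[OF emb_int_sign_act[OF \<epsilon>, of a], of "\<lambda>x. x $ i"] by simp
      then show ?thesis
        by (simp only: vec_eq_iff b_def emb_nth vec_lambda_beta of_int_max of_int_0) simp
    qed
    then have "emb b \<in> Pe \<epsilon>"
      using positive_part_mem_piece[OF piece \<epsilon> add(1)] by simp
    then have "Expo b 1 + g \<in> decomposable (Pe \<epsilon>)"
      by (intro decomposable_add decomposable_point g(1))
    moreover have "int_sign_act \<epsilon> (t_expo (Expo a 1 + f)) $ i \<le> t_expo (Expo b 1 + g) $ i" for i
      using g(3)[of i] by (auto simp: int_sign_act_add b_def)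
    ultimately show ?case
      using g(2) by (intro bexI[of _ "Expo b 1 + g"]) auto
  qed
  have "emb (int_sign_act \<epsilon> (t_expo e)) = real (s_expo e) *\<^sub>R sign_act \<epsilon> q"
    by (simp add: emb_int_sign_act \<epsilon> q(2) vec_eq_iff)
  then have "Expo (int_sign_act \<epsilon> (t_expo e)) (s_expo e) \<in> decomposable P"
    using assms(3) sign_act_piece_mem[OF piece[OF \<epsilon>] \<epsilon> q(1)] lattice_coneI
    unfolding integrally_decomposable_def by blast
  from dominated[OF this] obtain g where g: "g \<in> decomposable (Pe \<epsilon>)" "s_expo g = s_expo e"
    "\<And>i. t_expo e $ i \<le> t_expo g $ i"
    by (auto simp: int_sign_act_int_sign_act \<epsilon>)
  have "0 \<le> t_expo e $ i" for i
  proof -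
    have "0 \<le> real (s_expo e) * q $ i" using anti_blocking_nonneg[OF Q q(1)] by simp
    also have "\<dots> = real_of_int (t_expo e $ i)"
      using arg_cong[OF q(2), of "\<lambda>x. x $ i"] by simp
    finally show ?thesis by simp
  qed
  from decomposable_downward[OF Q g(1) this g(3)] show "e \<in> decomposable (Pe \<epsilon>)"
    by (simp add: g(2))
qed

theorem theorem2p2:
  fixes P :: "(real ^ 'n) set"
    and Pe :: "real ^ 'n \<Rightarrow> (real ^ 'n) set"
  assumes "locally_anti_blocking P"
    and "\<And>\<epsilon>. \<epsilon> \<in> sign_vectors \<Longrightarrow> anti_blocking_piece P \<epsilon> (Pe \<epsilon>)"
  shows "normal_subring (toric_ring P :: ('n, 'k::field) laurent set) \<longleftrightarrow>
    (\<forall>\<epsilon>\<in>sign_vectors. normal_subring (toric_ring (Pe \<epsilon>) :: ('n, 'k) laurent set))"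
proof -
  \<comment> \<open>The all-ones sign vector acts trivially, so its piece lies in \<open>P\<close>
    itself and supplies the origin and the unit vectors.\<close>
  define \<iota> :: "real ^ 'n" where "\<iota> = (\<chi> i. 1)"
  have \<iota>: "\<iota> \<in> sign_vectors" by (simp add: \<iota>_def sign_vectors_def)
  have act: "sign_act \<iota> y = y" for y by (simp add: \<iota>_def vec_eq_iff)
  have anti: "anti_blocking (Pe \<epsilon>)" if "\<epsilon> \<in> sign_vectors" for \<epsilon>
    using assms(2)[OF that] by (simp add: anti_blocking_piece_def)
  have "Pe \<iota> \<subseteq> P"
    using sign_act_piece_mem[OF assms(2)[OF \<iota>] \<iota>] by (auto simp: act)
  then have "0 \<in> P" "axis i 1 \<in> P" for i
    using anti_blocking_0 anti_blocking_axis anti[OF \<iota>] by blast+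
  moreover have "lattice_polytope P" using assms(1) by (simp add: locally_anti_blocking_def)
  ultimately have P: "normal_subring (toric_ring P :: ('n, 'k) laurent set) \<longleftrightarrow> integrally_decomposable P"
    by (intro normal_iff_integrally_decomposable)
  have pieces: "normal_subring (toric_ring (Pe \<epsilon>) :: ('n, 'k) laurent set) \<longleftrightarrow>
      integrally_decomposable (Pe \<epsilon>)" if "\<epsilon> \<in> sign_vectors" for \<epsilon>
    using anti[OF that] anti_blocking_0 anti_blocking_axis
    by (intro normal_iff_integrally_decomposable) (auto simp: anti_blocking_def)
  show ?thesis
    using P pieces integrally_decomposable_of_pieces[OF assms(2)]
      integrally_decomposable_piece[OF assms(2)] by blast
qed

end
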